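(* Let $K$ be a field and let $R=R(K[X,Y])$. Every finitely generated proper ideal of $R$ is contained in all but finitely many prime ideals of $R$.
   Context: For an integral domain $T$, the reciprocal complement $R(T)$ is the subring of the fraction field of $T$ generated by all $1/f$ with $f\in T\setminus\{0\}$. Here $K[X,Y]$ is the polynomial ring in two variables over $K$. *)

theory Defs
  imports
    "HOL-Computational_Algebra.Computational_Algebra"
    "HOL-Algebra.Ideal"
    "HOL-Algebra.Generated_Rings"
    "HOL-Algebra.Algebraic_Closure_Type"
begin

text \<open>
  The integral domain is given by a type of class \<open>idom\<close>; its fraction field is the
  library type \<open>'a fract\<close>, viewed as a HOL-Algebra ring by \<open>ring_of_type_algebra\<close>.
  The result is a ring whose carrier is in general a proper subset of that type, so its
  ideals and prime ideals are those of HOL-Algebra.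
\<close>

definition reciprocal_complement :: "'a::idom itself \<Rightarrow> 'a fract ring" where
  "reciprocal_complement T =
     (ring_of_type_algebra :: 'a fract ring)
       \<lparr>carrier := generate_ring ring_of_type_algebra {1 / to_fract f | f :: 'a. f \<noteq> 0}\<rparr>"

lemma domain_reciprocal_complement:
  "domain (reciprocal_complement TYPE('a::idom))"
proof -
  interpret F: field "ring_of_type_algebra :: 'a fract ring"
    by (rule field_from_type_algebra)
  have "{1 / to_fract f | f :: 'a. f \<noteq> 0} \<subseteq> carrier (ring_of_type_algebra :: 'a fract ring)"
    by (simp add: ring_of_type_algebra_def)
  then have "subring (generate_ring ring_of_type_algebra {1 / to_fract f | f :: 'a. f \<noteq> 0})
      (ring_of_type_algebra :: 'a fract ring)"
    by (rule F.generate_ring_is_subring)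
  then show ?thesis
    unfolding reciprocal_complement_def by (rule F.subring_is_domain)
qed

definition fg_ideal :: "'a set \<Rightarrow> ('a, 'b) ring_scheme \<Rightarrow> bool" where
  "fg_ideal I R \<longleftrightarrow> (\<exists>S. finite S \<and> S \<subseteq> carrier R \<and> I = Idl\<^bsub>R\<^esub> S)"

end

theory Submission
  imports Defs "HOL-Algebra.Ring_Divisibility"
begin

text \<open>
  Everything rests on attaching to a prime \<open>P\<close> of \<open>R(T)\<close>, for an arbitrary domain \<open>T\<close>, the set
  \<open>A\<close> of all \<open>f\<close> in \<open>T\<close> that are zero or satisfy \<open>1/f \<notin> P\<close>. The identity
  \<open>1/f \<cdot> 1/g = (1/f + 1/g) \<cdot> 1/(f + g)\<close> shows that \<open>A\<close> is closed under addition, and primality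
  makes it a subring that contains every divisor of each of its nonzero elements
  (\<open>away_add\<close>, \<open>away_saturated\<close>). A fraction of elements of \<open>A\<close> that lies in \<open>P\<close> must vanish, so a
  sum of reciprocals lies in \<open>P\<close> exactly when the summands \<open>1/g\<close> with \<open>g \<in> A\<close> cancel; hence
  \<open>P\<close> consists of the sums of reciprocals of elements outside \<open>A\<close>, and \<open>A\<close> determines \<open>P\<close>
  (\<open>P_eq_recip_sums\<close>).

  Now let \<open>T = K[X,Y]\<close> and let \<open>f\<close> be a nonzero nonunit with \<open>1/f \<notin> P\<close>, so that
  \<open>K[f] \<subseteq> A\<close>. An element algebraic over \<open>A\<close> divides a nonzero element of \<open>A\<close>, namely the lowest
  coefficient of a relation, and so lies in \<open>A\<close>: the subring \<open>A\<close> is algebraically closed in \<open>T\<close>.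
  As \<open>T\<close> has transcendence degree 2 over \<open>K\<close>, either \<open>A\<close> is the set of elements algebraic over
  \<open>K[f]\<close>, or \<open>A = T\<close> (\<open>away_dichotomy\<close>). So at most two primes do not contain \<open>1/f\<close>.

  It remains to see that an element \<open>x\<close> of a proper ideal is a sum of reciprocals of nonunits
  \<open>f\<^sub>1, \<dots>, f\<^sub>n\<close>: a prime not containing \<open>x\<close> then omits some \<open>1/f\<^sub>i\<close>, and a finitely
  generated ideal has only finitely many generators to treat. Let \<open>M\<close> be a maximal ideal with
  \<open>x \<in> M\<close>. Inverting \<open>1/f\<close> modulo \<open>M\<close> would put \<open>f\<close> itself into \<open>R(T)\<close>
  (\<open>recip_in_maximalideal\<close>), and a degree argument excludes that for nonconstant \<open>f\<close>. So \<open>M\<close>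
  contains all reciprocals of nonunits, and the constant part of \<open>x\<close>, being in \<open>M\<close>, is zero.
\<close>

section \<open>Sums of reciprocals\<close>

definition recip :: "'a::idom \<Rightarrow> 'a fract" where
  "recip f = 1 / to_fract f"

text \<open>
  The reciprocal complement is the case \<open>A = UNIV\<close>. Smaller \<open>A\<close> serve to separate the reciprocals
  in a prime from the others. Since \<open>recip 0 = 0\<close>, zero entries are harmless.
\<close>

definition recip_sums :: "'a::idom set \<Rightarrow> 'a fract set" where
  "recip_sums A = {\<Sum>g\<leftarrow>gs. recip g | gs. set gs \<subseteq> A}"

lemma recip_0 [simp]: "recip 0 = 0"
  by (simp add: recip_def)

lemma recip_1 [simp]: "recip 1 = 1"
  by (simp add: recip_def)

lemma recip_mult: "recip (f * g) = recip f * recip g"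
  by (simp add: recip_def)

lemma recip_uminus: "recip (- f) = - recip f"
  by (simp add: recip_def)

lemma recip_sums_induct [consumes 1, case_names zero add]:
  assumes "x \<in> recip_sums A" "P 0"
    and "\<And>g x. g \<in> A \<Longrightarrow> x \<in> recip_sums A \<Longrightarrow> P x \<Longrightarrow> P (recip g + x)"
  shows "P x"
proof -
  obtain gs where "x = (\<Sum>g\<leftarrow>gs. recip g)" "set gs \<subseteq> A"
    using assms(1) by (auto simp: recip_sums_def)
  then show ?thesis
    by (induction gs arbitrary: x) (use assms(2,3) in \<open>auto simp: recip_sums_def\<close>)
qed

lemma recip_sums_zero: "0 \<in> recip_sums A"
  unfolding recip_sums_def by (auto intro: exI[of _ "[]"])

lemma recip_sums_add_recip:
  "g \<in> A \<Longrightarrow> x \<in> recip_sums A \<Longrightarrow> recip g + x \<in> recip_sums A"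
  unfolding recip_sums_def by (force intro: exI[of _ "g # gs" for gs])

lemma recip_in_recip_sums: "g \<in> A \<Longrightarrow> recip g \<in> recip_sums A"
  using recip_sums_add_recip[OF _ recip_sums_zero, of g A] by simp

lemma recip_sums_add:
  assumes "x \<in> recip_sums A" "y \<in> recip_sums A"
  shows "x + y \<in> recip_sums A"
  using assms(1)
  by (induction rule: recip_sums_induct) (auto simp: assms(2) add.assoc recip_sums_add_recip)

text \<open>
  The set of finite sums is already a ring, because \<open>1/f \<cdot> 1/g = 1/(f g)\<close> and \<open>-(1/f) = 1/(-f)\<close>.
  No products or signs are therefore needed to describe the generated ring.
\<close>

lemma recip_sums_uminus: "x \<in> recip_sums UNIV \<Longrightarrow> - x \<in> recip_sums UNIV"
proof (induction rule: recip_sums_induct)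
  case (add g x)
  then show ?case
    using recip_sums_add_recip[of "- g" UNIV "- x"] by (simp add: recip_uminus)
qed (simp add: recip_sums_zero)

lemma recip_sums_recip_mult: "x \<in> recip_sums UNIV \<Longrightarrow> recip f * x \<in> recip_sums UNIV"
proof (induction rule: recip_sums_induct)
  case (add g x)
  then show ?case
    using recip_sums_add_recip[of "f * g" UNIV "recip f * x"]
    by (simp add: recip_mult distrib_left)
qed (simp add: recip_sums_zero)

lemma recip_sums_mult:
  "x \<in> recip_sums UNIV \<Longrightarrow> y \<in> recip_sums UNIV \<Longrightarrow> x * y \<in> recip_sums UNIV"
proof (induction rule: recip_sums_induct)
  case (add g x)
  then show ?case
    using recip_sums_add[OF recip_sums_recip_mult[of y g], of "x * y"]
    by (simp add: distrib_right)
qed (simp add: recip_sums_zero)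

lemma recip_sums_mono: "A \<subseteq> B \<Longrightarrow> recip_sums A \<subseteq> recip_sums B"
  unfolding recip_sums_def by blast

lemma uminus_type_algebra:
  "a_inv (ring_of_type_algebra :: 'a::field ring) x = - x"
proof -
  interpret F: field "ring_of_type_algebra :: 'a ring"
    by (rule field_from_type_algebra)
  show ?thesis
    by (rule F.add.inv_equality) (simp_all add: ring_of_type_algebra_def)
qed

lemma carrier_reciprocal_complement:
  "carrier (reciprocal_complement TYPE('a::idom)) = recip_sums UNIV"
proof -
  let ?F = "ring_of_type_algebra :: 'a fract ring"
  let ?G = "generate_ring ?F {1 / to_fract f | f :: 'a. f \<noteq> 0}"
  have "x \<in> recip_sums UNIV" if "x \<in> ?G" for x
    using that
  proof (induction rule: generate_ring.induct)
    case one
    then show ?case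
      using recip_in_recip_sums[of 1 UNIV] by (simp add: ring_of_type_algebra_def)
  next
    case (incl h)
    then show ?case
      using recip_in_recip_sums[of _ UNIV] by (auto simp: recip_def)
  next
    case (a_inv h)
    then show ?case by (simp add: uminus_type_algebra recip_sums_uminus)
  next
    case (eng_add h1 h2)
    then show ?case by (simp add: ring_of_type_algebra_def recip_sums_add)
  next
    case (eng_mult h1 h2)
    then show ?case by (simp add: ring_of_type_algebra_def recip_sums_mult)
  qed
  moreover have "x \<in> ?G" if "x \<in> recip_sums UNIV" for x
    using that
  proof (induction rule: recip_sums_induct)
    case zero
    have "1 + (- 1) \<in> ?G"
      using generate_ring.eng_add[OF generate_ring.one generate_ring.a_inv[OF generate_ring.one],
          of ?F "{1 / to_fract f | f :: 'a. f \<noteq> 0}"]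
      unfolding uminus_type_algebra by (simp add: ring_of_type_algebra_def)
    then show ?case by simp
  next
    case (add g x)
    show ?case
    proof (cases "g = 0")
      case False
      then have "recip g \<in> ?G"
        by (intro generate_ring.incl) (auto simp: recip_def)
      from generate_ring.eng_add[OF this add.IH] show ?thesis
        by (simp add: ring_of_type_algebra_def)
    qed (simp add: add.IH)
  qed
  ultimately show ?thesis
    by (auto simp: reciprocal_complement_def)
qed

lemma reciprocal_complement_ops:
  fixes x y :: "'a::idom fract"
  shows "x \<otimes>\<^bsub>reciprocal_complement TYPE('a)\<^esub> y = x * y"
    "x \<oplus>\<^bsub>reciprocal_complement TYPE('a)\<^esub> y = x + y"
    "\<zero>\<^bsub>reciprocal_complement TYPE('a)\<^esub> = 0"
    "\<one>\<^bsub>reciprocal_complement TYPE('a)\<^esub> = 1"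
  by (simp_all add: reciprocal_complement_def ring_of_type_algebra_def)

text \<open>
  A common denominator stays inside any set closed under addition and multiplication; this is what
  links sums of reciprocals over \<open>A\<close> with the fraction field of \<open>A\<close>.
\<close>

lemma recip_sums_fraction:
  assumes "y \<in> recip_sums A" "0 \<in> A" "1 \<in> A"
    and plus: "\<And>f g. f \<in> A \<Longrightarrow> g \<in> A \<Longrightarrow> f + g \<in> A"
    and mult: "\<And>f g. f \<in> A \<Longrightarrow> g \<in> A \<Longrightarrow> f * g \<in> A"
  shows "\<exists>p\<in>A. \<exists>q\<in>A. q \<noteq> 0 \<and> y = to_fract p / to_fract q"
  using assms(1)
proof (induction rule: recip_sums_induct)
  case zero
  have "(0::'a fract) = to_fract 0 / to_fract 1" by simp
  then show ?case using assms(2,3) zero_neq_one by metis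
next
  case (add g x)
  then obtain p q where pq: "p \<in> A" "q \<in> A" "q \<noteq> 0" "x = to_fract p / to_fract q"
    by auto
  show ?case
  proof (cases "g = 0")
    case False
    then have "recip g + x = to_fract (q + g * p) / to_fract (g * q)"
      using pq by (simp add: recip_def field_simps)
    moreover have "q + g * p \<in> A" "g * q \<in> A" "g * q \<noteq> 0"
      using pq add.hyps False by (auto intro: plus mult)
    ultimately show ?thesis by blast
  qed (use pq in auto)
qed

section \<open>The subring attached to a prime\<close>

locale recip_prime =
  fixes P :: "'a::idom fract set"
  assumes prime: "primeideal P (reciprocal_complement TYPE('a))"
begin

sublocale primeideal P "reciprocal_complement TYPE('a)"
  by (rule prime)

definition away :: "'a set" where
  "away = {f. f = 0 \<or> recip f \<notin> P}"

lemma P_sub: "P \<subseteq> recip_sums UNIV"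
  using a_subset by (simp add: carrier_reciprocal_complement)

lemma P_zero: "0 \<in> P"
  using additive_subgroup.zero_closed[OF is_additive_subgroup]
  by (simp add: reciprocal_complement_ops)

lemma P_add: "x \<in> P \<Longrightarrow> y \<in> P \<Longrightarrow> x + y \<in> P"
  using additive_subgroup.a_closed[OF is_additive_subgroup] by (simp add: reciprocal_complement_ops)

lemma P_mult: "x \<in> P \<Longrightarrow> r \<in> recip_sums UNIV \<Longrightarrow> r * x \<in> P"
  using I_l_closed[of x r] by (simp add: reciprocal_complement_ops carrier_reciprocal_complement)

lemma P_uminus: "x \<in> P \<Longrightarrow> - x \<in> P"
  using P_mult[of x "- 1"] recip_in_recip_sums[of "- 1" UNIV]
  by (simp add: recip_uminus)

lemma P_one: "1 \<notin> P"
  using one_imp_carrier I_notcarr by (auto simp: reciprocal_complement_ops)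

lemma P_prime:
  "x * y \<in> P \<Longrightarrow> x \<in> recip_sums UNIV \<Longrightarrow> y \<in> recip_sums UNIV \<Longrightarrow> x \<in> P \<or> y \<in> P"
  using I_prime by (simp add: reciprocal_complement_ops carrier_reciprocal_complement)

lemma away_zero: "0 \<in> away"
  by (simp add: away_def)

lemma away_one: "1 \<in> away"
  by (simp add: away_def P_one)

lemma away_mult: "f \<in> away \<Longrightarrow> g \<in> away \<Longrightarrow> f * g \<in> away"
  using P_prime[of "recip f" "recip g"]
  by (auto simp: away_def recip_mult recip_in_recip_sums)

text \<open>
  Where \<open>f\<close>, \<open>g\<close> and \<open>f + g\<close> are nonzero, the identity
  \<open>1/(f g) = (1/f + 1/g) \<cdot> 1/(f + g)\<close> holds in the reciprocal complement. If \<open>1/(f + g)\<close> were in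
  \<open>P\<close>, so would be the product of \<open>1/f\<close> and \<open>1/g\<close>, against primality.
\<close>

lemma away_add:
  assumes "f \<in> away" "g \<in> away"
  shows "f + g \<in> away"
proof (cases "f = 0 \<or> g = 0 \<or> f + g = 0")
  case True
  then show ?thesis using assms away_zero by auto
next
  case False
  then have "to_fract f + to_fract g \<noteq> 0"
    by (metis to_fract_add to_fract_eq_0_iff)
  with False have eq: "recip (f * g) = (recip f + recip g) * recip (f + g)"
    by (simp add: recip_def field_simps)
  have "recip (f * g) \<notin> P"
    using away_mult[OF assms] False by (simp add: away_def)
  then have "recip (f + g) \<notin> P"
    unfolding eq by (meson P_mult UNIV_I recip_in_recip_sums recip_sums_add)
  then show ?thesis by (simp add: away_def)
qed

text \<open>
  If \<open>c = k h\<close> then \<open>1/c\<close> is a multiple of \<open>1/h\<close> in the reciprocal complement.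
\<close>

lemma away_saturated:
  assumes "h dvd c" "c \<in> away" "c \<noteq> 0"
  shows "h \<in> away"
proof -
  obtain k where c: "c = k * h" using assms(1) by (auto simp: dvd_def mult.commute)
  have "recip c \<notin> P" using assms by (auto simp: away_def)
  then have "recip h \<notin> P"
    unfolding c recip_mult by (meson P_mult UNIV_I recip_in_recip_sums)
  then show ?thesis by (simp add: away_def)
qed

lemma away_unit: "c dvd 1 \<Longrightarrow> c \<in> away"
  using away_saturated[of c 1] away_one by simp

lemma away_sum: "finite J \<Longrightarrow> (\<And>i. i \<in> J \<Longrightarrow> v i \<in> away) \<Longrightarrow> sum v J \<in> away"
  by (induction rule: finite_induct) (auto simp: away_zero away_add)

lemma away_power: "f \<in> away \<Longrightarrow> f ^ n \<in> away"
  by (induction n) (auto simp: away_one away_mult)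

text \<open>
  If \<open>p \<noteq> 0\<close>, multiplying \<open>p/q\<close> by the ring element \<open>1/p\<close> puts \<open>1/q\<close> into \<open>P\<close>.
\<close>

lemma fraction_of_away_in_P:
  assumes "p \<in> away" "q \<in> away" "q \<noteq> 0" "to_fract p / to_fract q \<in> P"
  shows "p = 0"
proof (rule ccontr)
  assume "p \<noteq> 0"
  then have "recip q = recip p * (to_fract p / to_fract q)"
    by (simp add: recip_def)
  then have "recip q \<in> P"
    using P_mult[OF assms(4)] recip_in_recip_sums[of p UNIV] by simp
  with assms show False by (simp add: away_def)
qed

lemma recip_sums_split:
  assumes "x \<in> recip_sums UNIV"
  shows "\<exists>y\<in>recip_sums away. \<exists>z\<in>recip_sums (- away). x = y + z"
  using assms
proof (induction rule: recip_sums_induct)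
  case zero
  show ?case using recip_sums_zero by force
next
  case (add g x)
  then obtain y z where yz: "y \<in> recip_sums away" "z \<in> recip_sums (- away)" "x = y + z"
    by auto
  show ?case
  proof (cases "g \<in> away")
    case True
    then show ?thesis
      using yz recip_sums_add_recip[of g away y] by (metis add.assoc)
  next
    case False
    then show ?thesis
      using yz recip_sums_add_recip[of g "- away" z]
      by (metis ComplI add.left_commute)
  qed
qed

lemma away_fraction:
  assumes "y \<in> recip_sums away"
  shows "\<exists>p\<in>away. \<exists>q\<in>away. q \<noteq> 0 \<and> y = to_fract p / to_fract q"
  by (rule recip_sums_fraction[OF assms away_zero away_one away_add away_mult])

lemma recip_sums_not_away: "z \<in> recip_sums (- away) \<Longrightarrow> z \<in> P"
  by (induction rule: recip_sums_induct) (auto simp: P_zero P_add away_def)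

text \<open>
  In an element of \<open>P\<close> the summands \<open>1/g\<close> with \<open>g\<close> outside \<open>away\<close> lie in \<open>P\<close> anyway, so the
  remaining ones add up to an element of \<open>P\<close> that is a fraction over \<open>away\<close>, hence to zero. In
  particular two primes with the same \<open>away\<close> are equal.
\<close>

lemma P_eq_recip_sums: "P = recip_sums (- away)"
proof
  show "recip_sums (- away) \<subseteq> P" using recip_sums_not_away by blast
  show "P \<subseteq> recip_sums (- away)"
  proof
    fix x assume x: "x \<in> P"
    then obtain y z where yz: "y \<in> recip_sums away" "z \<in> recip_sums (- away)" "x = y + z"
      using recip_sums_split P_sub by blast
    have "- z \<in> P" by (rule P_uminus[OF recip_sums_not_away[OF yz(2)]])
    with x have "x + (- z) \<in> P" by (rule P_add)
    then have y: "y \<in> P" using yz(3) by simp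
    obtain p q where pq: "p \<in> away" "q \<in> away" "q \<noteq> 0" "y = to_fract p / to_fract q"
      using away_fraction[OF yz(1)] by blast
    have "p = 0"
      by (rule fraction_of_away_in_P[OF pq(1-3)]) (use y pq(4) in simp)
    then have "y = 0" using pq(4) by simp
    with yz show "x \<in> recip_sums (- away)" by simp
  qed
qed

end

section \<open>Maximal ideals\<close>

lemma (in cring) proper_ideal_in_maximalideal:
  assumes "ideal I R" "I \<noteq> carrier R"
  shows "\<exists>M. maximalideal M R \<and> I \<subseteq> M"
proof -
  define \<A> where "\<A> = {J. ideal J R \<and> I \<subseteq> J \<and> \<one> \<notin> J}"
  have "I \<in> \<A>"
    using assms ideal.one_imp_carrier unfolding \<A>_def by auto
  moreover have "\<Union>\<C> \<in> \<A>" if C: "\<C> \<noteq> {}" "subset.chain \<A> \<C>" for \<C>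
  proof -
    have "subset.chain {J. ideal J R} \<C>"
      using C(2) unfolding pred_on.chain_def \<A>_def by auto
    then have "ideal (\<Union>\<C>) R"
      using chain_Union_is_ideal[of \<C>] C(1) by auto
    then show ?thesis
      using C unfolding pred_on.chain_def \<A>_def by auto
  qed
  ultimately obtain M where M: "M \<in> \<A>" "\<And>J. J \<in> \<A> \<Longrightarrow> M \<subseteq> J \<Longrightarrow> J = M"
    using subset_Zorn_nonempty[of \<A>] by blast
  have "maximalideal M R"
  proof (rule maximalidealI)
    show "ideal M R" "carrier R \<noteq> M" using M(1) unfolding \<A>_def by auto
    fix J assume J: "ideal J R" "M \<subseteq> J" "J \<subseteq> carrier R"
    show "J = M \<or> J = carrier R"
      using M J ideal.one_imp_carrier[OF J(1)] unfolding \<A>_def by blast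
  qed
  then show ?thesis using M(1) unfolding \<A>_def by auto
qed

text \<open>
  If \<open>1/f \<notin> M\<close>, maximality gives \<open>b\<close> in the ring with \<open>b/f - 1 \<in> M\<close>. Discarding the
  summands of \<open>b\<close> that lie in \<open>M\<close> leaves \<open>y\<close> with \<open>y/f - 1 \<in> M\<close>, which is a fraction of elements
  of the subring \<open>away\<close> attached to \<open>M\<close>. Such a fraction vanishes, so \<open>f = y\<close> lies in the
  reciprocal complement.
\<close>

lemma recip_in_maximalideal:
  fixes f :: "'a::idom"
  assumes M: "maximalideal M (reciprocal_complement TYPE('a))"
    and f: "to_fract f \<notin> recip_sums UNIV"
  shows "recip f \<in> M"
proof (rule ccontr)
  let ?R = "reciprocal_complement TYPE('a)"
  interpret R: domain ?R by (rule domain_reciprocal_complement)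
  interpret M: maximalideal M ?R by (rule M)
  interpret recip_prime M
    by (rule recip_prime.intro[OF R.maximalideal_prime[OF M]])
  assume nf: "recip f \<notin> M"
  have f0: "f \<noteq> 0" using f recip_sums_zero[of UNIV] by auto
  have rf: "recip f \<in> carrier ?R"
    by (simp add: carrier_reciprocal_complement recip_in_recip_sums)
  \<comment> \<open>The ideal generated by \<open>M\<close> and \<open>1/f\<close>, in the field operations of the fraction field.\<close>
  define J where "J = {r * recip f + m | r m. r \<in> recip_sums UNIV \<and> m \<in> M}"
  have "ideal (PIdl\<^bsub>?R\<^esub> recip f <+>\<^bsub>?R\<^esub> M) ?R"
    by (intro R.add_ideals R.cgenideal_ideal rf M.is_ideal)
  moreover have J: "PIdl\<^bsub>?R\<^esub> recip f <+>\<^bsub>?R\<^esub> M = J"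
    unfolding J_def set_add_def' cgenideal_def
    by (auto simp: reciprocal_complement_ops carrier_reciprocal_complement)
  ultimately have "ideal J ?R" by simp
  moreover have "M \<subseteq> J"
    unfolding J_def using recip_sums_zero[of UNIV] by force
  moreover have "J \<subseteq> carrier ?R"
    using \<open>ideal J ?R\<close> by (simp add: additive_subgroup.a_subset ideal.axioms(1))
  moreover have "J \<noteq> M"
  proof -
    have "1 * recip f + 0 \<in> J"
      unfolding J_def using recip_in_recip_sums[of "1::'a" UNIV] P_zero
      by (metis (mono_tags, lifting) UNIV_I mem_Collect_eq recip_1)
    with nf show ?thesis by auto
  qed
  ultimately have "J = carrier ?R" using M.I_maximal by blast
  then have "1 \<in> J" using R.one_closed by (simp add: reciprocal_complement_ops)
  then obtain b m where bm: "b \<in> recip_sums UNIV" "m \<in> M" "1 = b * recip f + m"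
    unfolding J_def by auto
  obtain y z where yz: "y \<in> recip_sums away" "z \<in> recip_sums (- away)" "b = y + z"
    using recip_sums_split[OF bm(1)] by auto
  obtain p q where pq: "p \<in> away" "q \<in> away" "q \<noteq> 0" "y = to_fract p / to_fract q"
    using away_fraction[OF yz(1)] by blast
  have fa: "f \<in> away" using nf by (simp add: away_def)
  have "recip f * z + m \<in> M"
    by (intro P_add P_mult recip_sums_not_away yz bm recip_in_recip_sums UNIV_I)
  \<comment> \<open>Written with \<open>(-1) * p\<close>, the numerator is visibly in the subring \<open>away\<close>.\<close>
  moreover have "recip f * z + m = to_fract (q * f + (-1) * p) / to_fract (q * f)"
  proof -
    have "recip f * z + m = 1 - y * recip f"
      using bm(3) yz(3) by (simp add: algebra_simps)
    also have "\<dots> = to_fract (q * f + (-1) * p) / to_fract (q * f)"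
      using pq f0 by (simp add: recip_def field_simps)
    finally show ?thesis .
  qed
  ultimately have "to_fract (q * f + (-1) * p) / to_fract (q * f) \<in> M" by (simp only:)
  moreover have "- 1 \<in> away" by (rule away_unit) simp
  then have "q * f + (-1) * p \<in> away" by (intro away_add away_mult pq fa)
  moreover have "q * f \<in> away" "q * f \<noteq> 0"
    using pq fa f0 by (auto intro: away_mult)
  ultimately have "q * f + (-1) * p = 0"
    by (rule fraction_of_away_in_P[rotated 3])
  then have "p = q * f" by simp
  then have "to_fract f = y" using pq by simp
  then show False
    using f yz(1) recip_sums_mono[of away UNIV] by auto
qed


section \<open>Nonunits of a bivariate polynomial ring\<close>

lemma coeff_mult_add:
  assumes "degree p \<le> m" "degree q \<le> n"
  shows "coeff (p * q) (m + n) = coeff p m * coeff q n"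
proof -
  have "coeff (p * q) (m + n) = (\<Sum>i\<le>m + n. coeff p i * coeff q (m + n - i))"
    by (rule coeff_mult)
  also have "\<dots> = (\<Sum>i\<in>{m}. coeff p i * coeff q (m + n - i))"
  proof (rule sum.mono_neutral_right)
    show "\<forall>i\<in>{..m + n} - {m}. coeff p i * coeff q (m + n - i) = 0"
    proof
      fix i assume i: "i \<in> {..m + n} - {m}"
      show "coeff p i * coeff q (m + n - i) = 0"
      proof (cases "i < m")
        case True
        then have "coeff q (m + n - i) = 0" using assms by (intro coeff_eq_0) auto
        then show ?thesis by simp
      next
        case False
        then have "coeff p i = 0" using assms i by (intro coeff_eq_0) auto
        then show ?thesis by simp
      qed
    qed
  qed auto
  finally show ?thesis by simp
qed

text \<open>
  On \<open>K[X][Y]\<close>, the pair of the \<open>Y\<close>-degree and the \<open>X\<close>-degree of the leading coefficient, ordered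
  lexicographically, is minus a valuation. The conclusion says that \<open>y\<close> lies in its
  valuation ring, which contains all reciprocals. The coefficient of \<open>S\<close> is taken at position
  \<open>degree G\<close>, so that it is zero when \<open>S\<close> has the smaller \<open>Y\<close>-degree.
\<close>

lemma recip_sums_lex_degree:
  fixes y :: "'k::idom poly poly fract"
  assumes "y \<in> recip_sums UNIV"
  shows "\<exists>S G. G \<noteq> 0 \<and> y = to_fract S / to_fract G \<and> degree S \<le> degree G
    \<and> degree (coeff S (degree G)) \<le> degree (lead_coeff G)"
  using assms
proof (induction rule: recip_sums_induct)
  case zero
  show ?case by (rule exI[of _ 0], rule exI[of _ 1]) auto
next
  case (add g x)
  then obtain S G where SG: "G \<noteq> 0" "x = to_fract S / to_fract G" "degree S \<le> degree G"
    "degree (coeff S (degree G)) \<le> degree (lead_coeff G)" by auto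
  show ?case
  proof (cases "g = 0")
    case True
    then show ?thesis using SG by auto
  next
    case False
    have deg: "degree (g * G) = degree g + degree G"
      using False SG by (simp add: degree_mult_eq)
    have lc: "degree (lead_coeff (g * G)) = degree (lead_coeff g) + degree (lead_coeff G)"
      unfolding lead_coeff_mult by (rule degree_mult_eq) (use False SG in auto)
    have "degree (g * S) \<le> degree g + degree G"
      using degree_mult_le[of g S] SG by linarith
    then have "degree (G + g * S) \<le> degree (g * G)"
      unfolding deg by (intro degree_add_le) auto
    moreover have "degree (coeff (G + g * S) (degree (g * G))) \<le> degree (lead_coeff (g * G))"
    proof -
      have "degree (coeff G (degree g + degree G)) \<le> degree (lead_coeff G)"
        by (cases "degree g = 0") (auto simp: coeff_eq_0)
      moreover have "degree (coeff (g * S) (degree g + degree G))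
          \<le> degree (lead_coeff g) + degree (lead_coeff G)"
        using coeff_mult_add[of g "degree g" S "degree G"] SG
          degree_mult_le[of "lead_coeff g" "coeff S (degree G)"] by simp
      ultimately show ?thesis
        unfolding lc unfolding deg coeff_add by (intro degree_add_le) auto
    qed
    moreover have "recip g + x = to_fract (G + g * S) / to_fract (g * G)"
      using SG False by (simp add: recip_def field_simps)
    ultimately show ?thesis using False SG by (metis mult_eq_0_iff)
  qed
qed

lemma unit_if_to_fract_in_recip_sums:
  fixes f :: "'k::field poly poly"
  assumes "to_fract f \<in> recip_sums UNIV" "f \<noteq> 0"
  shows "f dvd 1"
proof -
  obtain S G where SG: "G \<noteq> 0" "to_fract f = to_fract S / to_fract G" "degree S \<le> degree G"
    "degree (coeff S (degree G)) \<le> degree (lead_coeff G)"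
    using recip_sums_lex_degree[OF assms(1)] by auto
  then have "to_fract (f * G) = to_fract S" by simp
  then have S: "S = f * G" by (metis to_fract_eq_iff)
  then have "degree f = 0" using SG assms(2) by (simp add: degree_mult_eq)
  then obtain u where u: "f = [:u:]" using degree_eq_zeroE by blast
  with assms(2) have "u \<noteq> 0" by auto
  then have "degree u = 0" using SG S u by (simp add: degree_mult_eq)
  with \<open>u \<noteq> 0\<close> show ?thesis
    unfolding u is_unit_const_poly_iff by (simp add: is_unit_iff_degree)
qed

section \<open>Algebraic dependence in a bivariate polynomial ring\<close>

definition algebraic_over :: "'a::idom set \<Rightarrow> 'a \<Rightarrow> bool" where
  "algebraic_over A h \<longleftrightarrow>
     (\<exists>N c. (\<forall>k\<le>N. c k \<in> A) \<and> (\<exists>k\<le>N. c k \<noteq> 0) \<and> (\<Sum>k\<le>N::nat. c k * h ^ k) = 0)"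

text \<open>
  In a nontrivial relation \<open>\<Sum>\<^sub>k c\<^sub>k h\<^sup>k = 0\<close> whose lowest nonzero coefficient is \<open>c\<^sub>m\<close>, the
  terms above \<open>m\<close> are divisible by \<open>h\<^bsup>m+1\<^esup>\<close>, so cancelling \<open>h\<^sup>m\<close> shows that \<open>h\<close> divides \<open>c\<^sub>m\<close>.
\<close>

lemma algebraic_over_dvd:
  assumes "algebraic_over A h" "h \<noteq> 0"
  shows "\<exists>c\<in>A. c \<noteq> 0 \<and> h dvd c"
proof -
  obtain N :: nat and c where c: "\<And>k. k \<le> N \<Longrightarrow> c k \<in> A" "\<exists>k\<le>N. c k \<noteq> 0"
    and eq: "(\<Sum>k\<le>N. c k * h ^ k) = 0"
    using assms(1) unfolding algebraic_over_def by blast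
  define m where "m = (LEAST k. k \<le> N \<and> c k \<noteq> 0)"
  have m: "m \<le> N" "c m \<noteq> 0"
    using LeastI_ex[of "\<lambda>k. k \<le> N \<and> c k \<noteq> 0"] c(2) unfolding m_def by blast+
  have below: "c k = 0" if "k < m" for k
    using that m(1) not_less_Least[of k "\<lambda>k. k \<le> N \<and> c k \<noteq> 0"] unfolding m_def by auto
  have "h ^ Suc m dvd c k * h ^ k" if "k \<in> {..N} - {m}" for k
  proof (cases "k < m")
    case False
    then have "Suc m \<le> k" using that by auto
    then show ?thesis by (intro dvd_mult le_imp_power_dvd)
  qed (simp add: below)
  then have "h ^ Suc m dvd (\<Sum>k\<in>{..N} - {m}. c k * h ^ k)"
    by (rule dvd_sum)
  moreover have "c m * h ^ m = - (\<Sum>k\<in>{..N} - {m}. c k * h ^ k)"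
    using eq m(1) by (simp add: sum.remove[of "{..N}" m] eq_neg_iff_add_eq_0)
  ultimately have "h * h ^ m dvd c m * h ^ m" by simp
  then have "h dvd c m" using assms(2) by simp
  with c(1) m show ?thesis by blast
qed

definition constants :: "'k::field poly poly set" where
  "constants = range (\<lambda>c. [:[:c:]:])"

text \<open>
  This is the subring \<open>K[f]\<close>.
\<close>

definition power_sums :: "'k::field poly poly \<Rightarrow> 'k poly poly set" where
  "power_sums f = {\<Sum>i\<le>N. [:[:c i:]:] * f ^ i | N c. True}"

lemma constant_dvd_one: "c \<noteq> 0 \<Longrightarrow> [:[:c:]:] dvd (1 :: 'k::field poly poly)"
  by (simp add: is_unit_const_poly_iff dvd_field_iff)

lemma unit_constant:
  fixes g :: "'k::field poly poly"
  assumes "g dvd 1"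
  shows "\<exists>b. b \<noteq> 0 \<and> g = [:[:b:]:]"
proof -
  obtain u where u: "g = [:u:]" "u dvd 1" using is_unit_polyE[OF assms] by metis
  obtain b where b: "u = [:b:]" "b dvd 1" using is_unit_polyE[OF u(2)] by metis
  then have "b \<noteq> 0" by auto
  with u(1) b(1) show ?thesis by blast
qed

text \<open>
  Otherwise \<open>f\<close> would divide a nonzero constant. So a nonunit is transcendental over \<open>K\<close>.
\<close>

lemma nonunit_not_algebraic_over_constants:
  assumes "f \<noteq> 0" "\<not> f dvd 1"
  shows "\<not> algebraic_over constants f"
proof
  assume "algebraic_over constants f"
  then obtain a where "a \<in> constants" "a \<noteq> 0" "f dvd a"
    using algebraic_over_dvd assms(1) by blast
  then obtain c where "c \<noteq> 0" "f dvd [:[:c:]:]" by (auto simp: constants_def)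
  moreover from \<open>c \<noteq> 0\<close> have "[:[:c:]:] dvd 1"
    by (rule constant_dvd_one)
  ultimately show False using assms(2) dvd_trans by blast
qed

text \<open>
  The relation is indexed by \<open>J\<close> and not by the vectors, so that coinciding vectors also count as a
  relation; otherwise counting monomials in possibly dependent elements would need a case
  distinction each time.
\<close>

lemma (in vector_space) nontrivial_relation:
  assumes "finite B" "finite J" "card B < card J" "v ` J \<subseteq> span B"
  shows "\<exists>c. (\<exists>j\<in>J. c j \<noteq> 0) \<and> (\<Sum>j\<in>J. c j *s v j) = 0"
proof (cases "inj_on v J")
  case True
  then have "card (v ` J) = card J" by (rule card_image)
  then have "dependent (v ` J)"
    using independent_span_bound[OF assms(1) _ assms(4)] assms(3) by force
  then obtain u where u: "\<exists>x\<in>v ` J. u x \<noteq> 0" "(\<Sum>x\<in>v ` J. u x *s x) = 0"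
    using dependent_finite[of "v ` J"] assms(2) by auto
  have "(\<Sum>j\<in>J. u (v j) *s v j) = 0"
    using u(2) by (simp add: sum.reindex[OF True])
  with u(1) show ?thesis by (intro exI[of _ "u \<circ> v"]) auto
next
  case False
  then obtain i j where ij: "i \<in> J" "j \<in> J" "i \<noteq> j" "v i = v j"
    by (auto simp: inj_on_def)
  define c where "c = (\<lambda>k. if k = i then 1 else if k = j then - 1 else 0 :: 'a)"
  have "(\<Sum>k\<in>J. c k *s v k) = (\<Sum>k\<in>{i, j}. c k *s v k)"
    by (rule sum.mono_neutral_right) (use assms(2) ij in \<open>auto simp: c_def\<close>)
  also have "\<dots> = 0" using ij by (simp add: c_def)
  finally show ?thesis using ij by (intro exI[of _ c]) (auto simp: c_def)
qed

definition bidegree_le :: "nat \<Rightarrow> 'k::field poly poly \<Rightarrow> bool" where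
  "bidegree_le D p \<longleftrightarrow> degree p \<le> D \<and> (\<forall>i. degree (coeff p i) \<le> D)"

lemma bidegree_le_mono: "bidegree_le D p \<Longrightarrow> D \<le> E \<Longrightarrow> bidegree_le E p"
  unfolding bidegree_le_def by (meson order_trans)

lemma bidegree_le_exists: "\<exists>D. bidegree_le D p"
proof -
  define D where "D = degree p + (\<Sum>i\<le>degree p. degree (coeff p i))"
  have "degree (coeff p i) \<le> D" for i
  proof (cases "i \<le> degree p")
    case True
    then have "degree (coeff p i) \<le> (\<Sum>i\<le>degree p. degree (coeff p i))"
      by (intro member_le_sum) auto
    then show ?thesis by (simp add: D_def)
  qed (simp add: coeff_eq_0)
  then have "bidegree_le D p" by (simp add: bidegree_le_def D_def)
  then show ?thesis ..
qed

lemma bidegree_le_mult: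
  assumes "bidegree_le D p" "bidegree_le E q"
  shows "bidegree_le (D + E) (p * q)"
proof -
  have "degree (p * q) \<le> D + E"
    using degree_mult_le[of p q] assms by (simp add: bidegree_le_def)
  moreover have "degree (coeff (p * q) i) \<le> D + E" for i
    unfolding coeff_mult
  proof (rule degree_sum_le)
    fix j
    show "degree (coeff p j * coeff q (i - j)) \<le> D + E"
      using degree_mult_le[of "coeff p j" "coeff q (i - j)"] assms
      unfolding bidegree_le_def by (meson add_mono order_trans)
  qed simp
  ultimately show ?thesis by (simp add: bidegree_le_def)
qed

lemma bidegree_le_power:
  assumes "bidegree_le D p" "n \<le> N"
  shows "bidegree_le (N * D) (p ^ n)"
proof -
  have "bidegree_le (n * D) (p ^ n)"
    by (induction n) (use assms(1) bidegree_le_mult in \<open>auto simp: bidegree_le_def[of 0]\<close>)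
  then show ?thesis by (rule bidegree_le_mono) (use assms(2) in simp)
qed

lemma vector_space_bivariate:
  "vector_space (\<lambda>c p. [:[:c:]:] * p :: 'k::field poly poly)"
  by unfold_locales (simp_all add: smult_add_right mult.commute flip: smult_add_left one_pCons)

text \<open>
  Only an upper bound for a dimension is wanted here, so that it suffices to name
  \<open>(D + 1)\<^sup>2\<close> spanning elements, the monomials \<open>X\<^sup>i Y\<^sup>j\<close>.
\<close>

lemma bidegree_le_span:
  assumes "bidegree_le D p"
  shows "p \<in> module.span (\<lambda>c p. [:[:c:]:] * p)
    ((\<lambda>(i, j). monom (monom 1 i) j) ` ({..D} \<times> {..D}))"
proof -
  interpret K: vector_space "\<lambda>c p. [:[:c:]:] * p :: 'a poly poly"
    by (rule vector_space_bivariate)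
  have "p = (\<Sum>j\<le>D. monom (coeff p j) j)"
    using assms by (intro poly_as_sum_of_monoms'[symmetric]) (simp add: bidegree_le_def)
  also have "\<dots> = (\<Sum>j\<le>D. \<Sum>i\<le>D. [:[:coeff (coeff p j) i:]:] * monom (monom 1 i) j)"
  proof (rule sum.cong[OF refl])
    fix j
    have "coeff p j = (\<Sum>i\<le>D. monom (coeff (coeff p j) i) i)"
      using assms by (intro poly_as_sum_of_monoms'[symmetric]) (simp add: bidegree_le_def)
    then have "monom (coeff p j) j = (\<Sum>i\<le>D. monom (monom (coeff (coeff p j) i) i) j)"
      by (metis (no_types, lifting) monom_sum sum.cong)
    then show "monom (coeff p j) j = (\<Sum>i\<le>D. [:[:coeff (coeff p j) i:]:] * monom (monom 1 i) j)"
      by (simp add: smult_monom)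
  qed
  also have "\<dots> \<in> K.span ((\<lambda>(i, j). monom (monom 1 i) j) ` ({..D} \<times> {..D}))"
    by (intro K.span_sum K.span_scale K.span_base) auto
  finally show ?thesis .
qed

text \<open>
  This is the fact that \<open>K[X,Y]\<close> has transcendence degree at most 2. The monomials in \<open>f, g, h\<close>
  with exponents up to \<open>N\<close> number \<open>(N + 1)\<^sup>3\<close>, whereas their degree in each variable is at most
  linear in \<open>N\<close>, so they lie in a space whose dimension grows only quadratically with \<open>N\<close>.
\<close>

lemma bivariate_three_dependent:
  fixes f g h :: "'k::field poly poly"
  shows "\<exists>N c. (\<exists>k\<le>N. \<exists>j\<le>N. \<exists>i\<le>N. c k j i \<noteq> 0) \<and>
    (\<Sum>k\<le>N. (\<Sum>j\<le>N. (\<Sum>i\<le>N. [:[:c k j i:]:] * f ^ i) * g ^ j) * h ^ k) = 0"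
proof -
  interpret K: vector_space "\<lambda>c p. [:[:c:]:] * p :: 'k poly poly"
    by (rule vector_space_bivariate)
  obtain D1 D2 D3 where "bidegree_le D1 f" "bidegree_le D2 g" "bidegree_le D3 h"
    using bidegree_le_exists by metis
  then obtain D where D: "bidegree_le D f" "bidegree_le D g" "bidegree_le D h"
    by (meson bidegree_le_mono[of _ _ "D1 + D2 + D3"] le_add1 le_add2 le_trans)
  \<comment> \<open>This \<open>N\<close> makes the bound \<open>(3 (D + 1) (N + 1))\<^sup>2\<close> for the dimension equal to \<open>N (N + 1)\<^sup>2\<close>.\<close>
  define N where "N = 9 * (D + 1)\<^sup>2"
  have sq: "(3 * (D + 1))\<^sup>2 = N"
    by (simp only: N_def power_mult_distrib) simp
  define E where "E = N * D + N * D + N * D"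
  define B where "B = (\<lambda>(i, j). monom (monom 1 i) j :: 'k poly poly) ` ({..E} \<times> {..E})"
  define J where "J = {..N} \<times> {..N} \<times> {..N}"
  define v where "v = (\<lambda>(k, j, i). f ^ i * g ^ j * h ^ k)"
  have "card B \<le> card ({..E} \<times> {..E})"
    unfolding B_def by (rule card_image_le) simp
  also have "\<dots> = (E + 1)\<^sup>2" by (simp add: power2_eq_square card_cartesian_product)
  also have "\<dots> \<le> (3 * (D + 1) * (N + 1))\<^sup>2"
    by (rule power_mono) (simp_all add: E_def algebra_simps)
  also have "\<dots> = N * (N + 1)\<^sup>2"
    by (simp only: power_mult_distrib[of "3 * (D + 1)"] sq)
  also have "\<dots> < (N + 1) * (N + 1)\<^sup>2" by simp
  also have "\<dots> = card J" by (simp add: J_def card_cartesian_product power2_eq_square)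
  finally have card: "card B < card J" .
  have "v ` J \<subseteq> K.span B"
  proof
    fix x assume "x \<in> v ` J"
    then obtain k j i where x: "x = f ^ i * g ^ j * h ^ k" and le: "k \<le> N" "j \<le> N" "i \<le> N"
      by (auto simp: v_def J_def)
    have "bidegree_le E x"
      unfolding x E_def by (intro bidegree_le_mult bidegree_le_power D le)
    then show "x \<in> K.span B" unfolding B_def by (rule bidegree_le_span)
  qed
  then obtain c where c: "\<exists>j\<in>J. c j \<noteq> 0" "(\<Sum>j\<in>J. [:[:c j:]:] * v j) = 0"
    using K.nontrivial_relation[of B J v] card unfolding B_def J_def by auto
  have "(\<Sum>k\<le>N. (\<Sum>j\<le>N. (\<Sum>i\<le>N. [:[:c (k, j, i):]:] * f ^ i) * g ^ j) * h ^ k)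
      = (\<Sum>k\<le>N. \<Sum>j\<le>N. \<Sum>i\<le>N. [:[:c (k, j, i):]:] * v (k, j, i))"
    by (simp add: v_def sum_distrib_right mult.assoc)
  also have "\<dots> = (\<Sum>j\<in>J. [:[:c j:]:] * v j)"
    by (simp add: J_def sum.cartesian_product case_prod_unfold)
  finally show ?thesis
    using c by (intro exI[of _ N] exI[of _ "\<lambda>k j i. c (k, j, i)"]) (auto simp: J_def)
qed

section \<open>Primes not containing a given element\<close>

text \<open>
  If \<open>away\<close> contains some \<open>g\<close> transcendental over \<open>K[f]\<close>, then any \<open>h\<close> satisfies a relation with
  \<open>f\<close> and \<open>g\<close>. Read as a polynomial in \<open>h\<close>, its coefficients lie in \<open>away\<close> and do not all
  vanish, because \<open>f\<close> and \<open>g\<close> are independent; so \<open>h\<close> is algebraic over \<open>away\<close> and thus belongs to it.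
\<close>

lemma away_dichotomy:
  fixes f :: "'k::field poly poly"
  assumes "recip_prime P" "f \<noteq> 0" "\<not> f dvd 1" "recip f \<notin> P"
  shows "recip_prime.away P \<in> {UNIV, {h. algebraic_over (power_sums f) h}}"
proof -
  interpret recip_prime P by fact
  have f: "f \<in> away" using assms(4) by (simp add: away_def)
  have const: "[:[:c:]:] \<in> away" for c
  proof (cases "c = 0")
    case False
    then show ?thesis by (intro away_unit constant_dvd_one)
  qed (simp add: away_zero)
  have sums: "power_sums f \<subseteq> away"
    unfolding power_sums_def
    by (clarify, intro away_sum away_mult away_power const f) simp
  have alg: "h \<in> away" if h: "algebraic_over A h" and A: "A \<subseteq> away" for A h
  proof (cases "h = 0")
    case False
    with h obtain c where "c \<in> A" "c \<noteq> 0" "h dvd c" using algebraic_over_dvd by blast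
    with A show ?thesis using away_saturated by blast
  qed (simp add: away_zero)
  show ?thesis
  proof (cases "\<forall>g\<in>away. algebraic_over (power_sums f) g")
    case True
    then have "away = {h. algebraic_over (power_sums f) h}"
      using alg sums by blast
    then show ?thesis by simp
  next
    case False
    then obtain g where g: "g \<in> away" "\<not> algebraic_over (power_sums f) g" by auto
    have "h \<in> away" for h
    proof -
      obtain N c where c: "\<exists>k\<le>N. \<exists>j\<le>N. \<exists>i\<le>N. c k j i \<noteq> 0" and
        eq: "(\<Sum>k\<le>N. (\<Sum>j\<le>N. (\<Sum>i\<le>N. [:[:c k j i:]:] * f ^ i) * g ^ j) * h ^ k) = 0"
        using bivariate_three_dependent[of f g h] by blast
      define d where "d = (\<lambda>k j. \<Sum>i\<le>N. [:[:c k j i:]:] * f ^ i)"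
      define e where "e = (\<lambda>k. \<Sum>j\<le>N. d k j * g ^ j)"
      obtain k j i where kji: "k \<le> N" "j \<le> N" "i \<le> N" "c k j i \<noteq> 0" using c by auto
      have "d k j \<noteq> 0"
      proof
        assume "d k j = 0"
        then have "algebraic_over constants f"
          unfolding algebraic_over_def d_def using kji(3,4)
          by (intro exI[of _ N] exI[of _ "\<lambda>i. [:[:c k j i:]:]"]) (auto simp: constants_def)
        then show False using nonunit_not_algebraic_over_constants assms by blast
      qed
      moreover have dP: "d k j \<in> power_sums f" for k j
        unfolding d_def power_sums_def by blast
      ultimately have "e k \<noteq> 0"
        using g(2) kji(2) unfolding algebraic_over_def e_def by blast
      moreover have "e k \<in> away" for k
        unfolding e_def using dP sums g(1) by (intro away_sum away_mult away_power) auto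
      moreover have "(\<Sum>k\<le>N. e k * h ^ k) = 0"
        using eq by (simp add: e_def d_def)
      ultimately have "algebraic_over away h"
        unfolding algebraic_over_def using kji(1) by blast
      then show ?thesis using alg by blast
    qed
    then show ?thesis by auto
  qed
qed

text \<open>
  There are at most two such primes, since \<open>P\<close> is recovered from one of two possible subrings.
\<close>

lemma finite_primes_missing_recip:
  fixes f :: "'k::field poly poly"
  assumes "f \<noteq> 0" "\<not> f dvd 1"
  shows "finite {P. recip_prime P \<and> recip f \<notin> P}"
proof -
  define \<A> where "\<A> = {UNIV, {h. algebraic_over (power_sums f) h}}"
  have "P \<in> (\<lambda>A. recip_sums (- A)) ` \<A>" if P: "recip_prime P" "recip f \<notin> P" for P
  proof -
    have "recip_prime.away P \<in> \<A>"
      unfolding \<A>_def by (rule away_dichotomy[OF P(1) assms P(2)])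
    moreover have "P = recip_sums (- recip_prime.away P)"
      by (rule recip_prime.P_eq_recip_sums[OF P(1)])
    ultimately show ?thesis by blast
  qed
  then have "{P. recip_prime P \<and> recip f \<notin> P} \<subseteq> (\<lambda>A. recip_sums (- A)) ` \<A>"
    by blast
  moreover have "finite \<A>" by (simp add: \<A>_def)
  ultimately show ?thesis by (meson finite_imageI finite_subset)
qed

text \<open>
  Every ring element is a constant plus a sum of reciprocals of nonunits, since the units of
  \<open>K[X,Y]\<close> are the nonzero constants. For an element of \<open>M\<close> the constant lies in \<open>M\<close>, as the rest
  does, and a nonzero constant is invertible.
\<close>

lemma sum_of_nonunit_recips:
  fixes M :: "'k::field poly poly fract set"
  assumes M: "maximalideal M (reciprocal_complement TYPE('k poly poly))" and x: "x \<in> M"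
  shows "x \<in> recip_sums {f. f \<noteq> 0 \<and> \<not> f dvd 1}"
proof -
  let ?R = "reciprocal_complement TYPE('k poly poly)"
  let ?N = "{f :: 'k poly poly. f \<noteq> 0 \<and> \<not> f dvd 1}"
  interpret R: domain ?R by (rule domain_reciprocal_complement)
  interpret recip_prime M
    by (rule recip_prime.intro[OF R.maximalideal_prime[OF M]])
  have recip_M: "recip f \<in> M" if "f \<in> ?N" for f
    using that recip_in_maximalideal[OF M, of f] unit_if_to_fract_in_recip_sums[of f] by auto
  have sums_M: "z \<in> M" if "z \<in> recip_sums ?N" for z
    using that by (induction rule: recip_sums_induct) (auto simp: P_zero P_add recip_M)
  have split: "\<exists>c. \<exists>z\<in>recip_sums ?N. y = to_fract [:[:c:]:] + z" if "y \<in> recip_sums UNIV" for y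
    using that
  proof (induction rule: recip_sums_induct)
    case zero
    have "(0 :: 'k poly poly fract) = to_fract [:[:0:]:] + 0" by simp
    then show ?case using recip_sums_zero by blast
  next
    case (add g y)
    then obtain c z where cz: "z \<in> recip_sums ?N" "y = to_fract [:[:c:]:] + z" by auto
    consider "g = 0" | "g \<in> ?N" | "g \<noteq> 0" "g dvd 1" by auto
    then show ?case
    proof cases
      case 1
      then have "recip g + y = to_fract [:[:c:]:] + z" using cz by simp
      then show ?thesis using cz(1) by blast
    next
      case 2
      then have "recip g + z \<in> recip_sums ?N" by (rule recip_sums_add_recip[OF _ cz(1)])
      moreover have "recip g + y = to_fract [:[:c:]:] + (recip g + z)"
        unfolding cz(2) by (rule add.left_commute)
      ultimately show ?thesis by blast
    next
      case 3
      then obtain b where b: "g = [:[:b:]:]" "b \<noteq> 0" using unit_constant by blast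
      then have "g * [:[:inverse b:]:] = 1" by (simp add: b one_pCons)
      then have "to_fract g * to_fract [:[:inverse b:]:] = 1"
        by (metis to_fract_1 to_fract_mult)
      then have "recip g = to_fract [:[:inverse b:]:]"
        using 3 by (simp add: recip_def nonzero_divide_eq_eq mult.commute)
      moreover have "to_fract [:[:inverse b + c:]:] = to_fract [:[:inverse b:]:] + to_fract [:[:c:]:]"
        using to_fract_add[of "[:[:inverse b:]:]" "[:[:c:]:]"] by simp
      ultimately have "recip g + y = to_fract [:[:inverse b + c:]:] + z"
        unfolding cz(2) by (simp only: add.assoc)
      then show ?thesis using cz(1) by blast
    qed
  qed
  then obtain c z where cz: "z \<in> recip_sums ?N" "x = to_fract [:[:c:]:] + z"
    using x P_sub by blast
  have "to_fract [:[:c:]:] = x + (- z)" using cz by simp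
  then have cM: "to_fract [:[:c:]:] \<in> M"
    using P_add[OF x P_uminus[OF sums_M[OF cz(1)]]] by simp
  have "c = 0"
  proof (rule ccontr)
    assume "c \<noteq> 0"
    then have "recip [:[:c:]:] * to_fract [:[:c:]:] = 1" by (simp add: recip_def)
    then show False
      using P_mult[OF cM, of "recip [:[:c:]:]"] P_one recip_in_recip_sums[of "[:[:c:]:]" UNIV]
      by simp
  qed
  with cz show ?thesis by simp
qed

lemma finite_primes_missing_element:
  fixes x :: "'k::field poly poly fract"
  assumes "x \<in> recip_sums {f. f \<noteq> 0 \<and> \<not> f dvd 1}"
  shows "finite {P. recip_prime P \<and> x \<notin> P}"
  using assms
proof (induction rule: recip_sums_induct)
  case zero
  have "{P :: 'k poly poly fract set. recip_prime P \<and> 0 \<notin> P} = {}"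
    using recip_prime.P_zero by blast
  then show ?case by (simp only: finite.emptyI)
next
  case (add g x)
  have "{P. recip_prime P \<and> recip g + x \<notin> P}
      \<subseteq> {P. recip_prime P \<and> recip g \<notin> P} \<union> {P. recip_prime P \<and> x \<notin> P}"
    using recip_prime.P_add by blast
  then show ?case
    using add finite_primes_missing_recip[of g] by (auto intro: finite_subset)
qed

theorem theorem7p5:
  fixes R :: "'k::field poly poly fract ring"
    and I :: "'k poly poly fract set"
  assumes "R = reciprocal_complement TYPE('k poly poly)"
    and "fg_ideal I R"
    and "I \<noteq> carrier R"
  shows "finite {P. primeideal P R \<and> \<not> I \<subseteq> P}"
proof -
  interpret R: domain R unfolding assms(1) by (rule domain_reciprocal_complement)
  obtain S where S: "finite S" "S \<subseteq> carrier R" "I = Idl\<^bsub>R\<^esub> S"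
    using assms(2) unfolding fg_ideal_def by blast
  have "ideal I R" using S R.genideal_ideal by simp
  then obtain M where M: "maximalideal M R" "I \<subseteq> M"
    using R.proper_ideal_in_maximalideal assms(3) by blast
  have fin: "finite {P. recip_prime P \<and> s \<notin> P}" if "s \<in> S" for s
  proof -
    have "s \<in> M" using that S M(2) R.genideal_self by blast
    then show ?thesis
      using M(1) unfolding assms(1)
      by (intro finite_primes_missing_element sum_of_nonunit_recips)
  qed
  have "{P. primeideal P R \<and> \<not> I \<subseteq> P} \<subseteq> (\<Union>s\<in>S. {P. recip_prime P \<and> s \<notin> P})"
  proof
    fix P assume "P \<in> {P. primeideal P R \<and> \<not> I \<subseteq> P}"
    then have P: "primeideal P R" "\<not> I \<subseteq> P" by auto
    have "\<not> S \<subseteq> P"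
      using P S(3) R.genideal_minimal[OF primeideal.axioms(1)[OF P(1)]] by blast
    then show "P \<in> (\<Union>s\<in>S. {P. recip_prime P \<and> s \<notin> P})"
      using P(1) unfolding assms(1) by (auto intro: recip_prime.intro)
  qed
  then show ?thesis
    by (rule finite_subset) (use S(1) fin in blast)
qed

end
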